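(* Let $X$ be a finite universe and $E$ a finite set of parameters. Define, for type-2 soft sets $[\mathscr{F},A],[\mathscr{G},B]\in S_2(X,E)$, $$S_m([\mathscr{F},A],[\mathscr{G},B])=\begin{cases}\dfrac{1}{|A\cup B|}\displaystyle\sum_{\alpha\in A\cap B}S(\alpha) & \text{if }A\cap B\neq\varnothing,\\[4pt] 0 & \text{otherwise,}\end{cases}$$ where, for $\alpha\in A\cap B$, $$S(\alpha)=\begin{cases}\dfrac{1}{|E_A^\alpha\cup E_B^\alpha|}\displaystyle\sum_{\beta\in E_A^\alpha\cap E_B^\alpha}\frac{|F_\alpha(\beta)\cap G_\alpha(\beta)|}{|F_\alpha(\beta)\cup G_\alpha(\beta)|} & \text{if }E_A^\alpha\cap E_B^\alpha\ne\varnothing,\\[4pt] 0&\text{otherwise.}\end{cases}$$ Then $S_m$ is a (real valued) similarity measure between type-2 soft sets.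
   Context: A type-1 soft set over $(X,E)$ is a pair $(F,P)$ with $P\subseteq E$ and $F:P\to\mathscr{P}(X)$. Containment: $(F,P)\,\tilde\subseteq\,(G,Q)$ iff $P\subseteq Q$ and $F(\beta)=G(\beta)$ for all $\beta\in P$. For $Q\subseteq E$, $S(X,Q)$ is the set of type-1 soft sets whose parameter set is contained in $Q$. A type-2 soft set $[\mathscr{F},A]$ over $(X,E)$ consists of a set $A\subseteq E$ (primary parameters), a set $E_A\subseteq E$ (underlying parameters) and a mapping $\mathscr{F}:A\to S(X,E_A)$; write $\mathscr{F}(\alpha)=(F_\alpha,E_A^\alpha)$ with $E_A^\alpha\subseteq E_A$ and $F_\alpha:E_A^\alpha\to\mathscr{P}(X)$; it is required that $\bigcup_{\alpha\in A}E_A^\alpha=E_A$. (The sets $E_A^\alpha$, $E_A$ belong to $[\mathscr{F},A]$, not merely to $A$; for $[\mathscr{G},B]$ one writes $(G_\alpha,E_B^\alpha)$ and $E_B$.) $S_2(X,E)$ is the set of all type-2 soft sets over $(X,E)$. Containment: $[\mathscr{F},A]\sqsubseteq[\mathscr{G},B]$ iff $A\subseteq B$ and $\mathscr{F}(\alpha)\,\tilde\subseteq\,\mathscr{G}(\alpha)$ for all $\alpha\in A$; equality is mutual containment. The formula for $S(\alpha)$ is considered for pairs for which its quotients are defined, i.e. $F_\alpha(\beta)\cup G_\alpha(\beta)\ne\varnothing$ for all $\beta$ occurring in the sum. A mapping $S_m:S_2(X,E)\times S_2(X,E)\to[0,\infty)$ is a measure of similarity if for all $[\mathscr{F},A],[\mathscr{G},B],[\mathscr{H},C]\in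 S_2(X,E)$: (s1) $S_m([\mathscr{F},A],[\mathscr{G},B])=S_m([\mathscr{G},B],[\mathscr{F},A])$; (s2) $0\le S_m([\mathscr{F},A],[\mathscr{G},B])\le1$; (s3) $S_m([\mathscr{F},A],[\mathscr{G},B])=1$ iff $[\mathscr{F},A]=[\mathscr{G},B]$; (s4) if $[\mathscr{F},A]\sqsubseteq[\mathscr{G},B]\sqsubseteq[\mathscr{H},C]$ then $S_m([\mathscr{F},A],[\mathscr{H},C])\le\min\{S_m([\mathscr{F},A],[\mathscr{G},B]),\,S_m([\mathscr{G},B],[\mathscr{H},C])\}$.
   Formalization: In (s3), "equality implies S_m = 1" is claimed only if A∪B and every E_A^α∪E_B^α (α in A∩B) are nonempty; otherwise it fails, e.g. A=B=∅ gives S_m=0. All else is proved for all pairs with defined quotients. *)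

theory Defs
  imports Complex_Main
begin

text \<open>
  A type-1 soft set \<open>(F, P)\<close> is the partial map with domain \<open>P\<close> that sends \<open>\<beta> \<in> P\<close> to
  \<open>F(\<beta>)\<close>.  The containment of type-1 soft sets is then the library relation \<open>\<subseteq>\<^sub>m\<close>:
  inclusion of domains and equality of the values on the smaller domain.
\<close>

type_synonym ('e, 'x) soft1 = "'e \<rightharpoonup> 'x set"

definition soft1_sets :: "'x set \<Rightarrow> 'e set \<Rightarrow> ('e, 'x) soft1 set" where
  "soft1_sets X Q = {P. dom P \<subseteq> Q \<and> ran P \<subseteq> Pow X}"

text \<open>
  A type-2 soft set \<open>[F, A]\<close> consists of the set \<open>E\<^sub>A\<close> (field \<open>under\<close>) and a partial map
  (field \<open>fam\<close>) whose domain is \<open>A\<close>.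
\<close>

record ('e, 'x) soft2 =
  under :: "'e set"
  fam :: "'e \<rightharpoonup> ('e, 'x) soft1"

definition prim :: "('e, 'x) soft2 \<Rightarrow> 'e set" where
  "prim T = dom (fam T)"

text \<open>The type-1 soft set assigned to \<open>\<alpha>\<close>; meaningful only for \<open>\<alpha> \<in> prim T\<close>.\<close>

definition soft_at :: "('e, 'x) soft2 \<Rightarrow> 'e \<Rightarrow> ('e, 'x) soft1" where
  "soft_at T \<alpha> = the (fam T \<alpha>)"

definition soft2_sets :: "'x set \<Rightarrow> 'e set \<Rightarrow> ('e, 'x) soft2 set" where
  "soft2_sets X E = {T. prim T \<subseteq> E \<and> under T \<subseteq> E
     \<and> (\<forall>\<alpha>\<in>prim T. soft_at T \<alpha> \<in> soft1_sets X (under T))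
     \<and> (\<Union>\<alpha>\<in>prim T. dom (soft_at T \<alpha>)) = under T}"

definition soft2_le :: "('e, 'x) soft2 \<Rightarrow> ('e, 'x) soft2 \<Rightarrow> bool" (infix "\<sqsubseteq>\<^sub>2" 50) where
  "F \<sqsubseteq>\<^sub>2 G \<longleftrightarrow> prim F \<subseteq> prim G \<and> (\<forall>\<alpha>\<in>prim F. soft_at F \<alpha> \<subseteq>\<^sub>m soft_at G \<alpha>)"

definition soft2_eq :: "('e, 'x) soft2 \<Rightarrow> ('e, 'x) soft2 \<Rightarrow> bool" (infix "\<approx>\<^sub>2" 50) where
  "F \<approx>\<^sub>2 G \<longleftrightarrow> F \<sqsubseteq>\<^sub>2 G \<and> G \<sqsubseteq>\<^sub>2 F"

lemma soft2_eq_iff_eq: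
  assumes "F \<in> soft2_sets X E" "G \<in> soft2_sets X E"
  shows "F \<approx>\<^sub>2 G \<longleftrightarrow> F = G"
proof
  assume eq: "F \<approx>\<^sub>2 G"
  have p: "prim F = prim G"
    using eq by (auto simp: soft2_eq_def soft2_le_def)
  have s: "soft_at F \<alpha> = soft_at G \<alpha>" if "\<alpha> \<in> prim F" for \<alpha>
    using eq that p by (auto simp: soft2_eq_def soft2_le_def intro: map_le_antisym)
  have "fam F \<alpha> = fam G \<alpha>" for \<alpha>
    using p s[of \<alpha>] unfolding prim_def soft_at_def
    by (metis domIff option.expand)
  moreover have "under F = under G"
    using assms p s by (auto simp: soft2_sets_def)
  ultimately show "F = G"
    by (intro soft2.equality) auto
qed (auto simp: soft2_eq_def soft2_le_def)

definition S_alpha :: "('e, 'x) soft2 \<Rightarrow> ('e, 'x) soft2 \<Rightarrow> 'e \<Rightarrow> real" where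
  "S_alpha F G \<alpha> =
     (let P = soft_at F \<alpha>; Q = soft_at G \<alpha> in
      if dom P \<inter> dom Q \<noteq> {}
      then 1 / real (card (dom P \<union> dom Q)) *
           (\<Sum>\<beta>\<in>dom P \<inter> dom Q. real (card (the (P \<beta>) \<inter> the (Q \<beta>)))
                                  / real (card (the (P \<beta>) \<union> the (Q \<beta>))))
      else 0)"

definition S_m :: "('e, 'x) soft2 \<Rightarrow> ('e, 'x) soft2 \<Rightarrow> real" where
  "S_m F G =
     (if prim F \<inter> prim G \<noteq> {}
      then 1 / real (card (prim F \<union> prim G)) * (\<Sum>\<alpha>\<in>prim F \<inter> prim G. S_alpha F G \<alpha>)
      else 0)"

text \<open>
  The axioms of a similarity measure, relative to a set \<open>D\<close> of pairs on which the measure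
  is considered; \<open>D = soft2_sets X E \<times> soft2_sets X E\<close> is the unrestricted notion.
  Nonnegativity of the values is part of \<open>sim_bounded_on\<close>.
\<close>

definition sim_symmetric_on ::
  "(('e, 'x) soft2 \<times> ('e, 'x) soft2) set \<Rightarrow> (('e, 'x) soft2 \<Rightarrow> ('e, 'x) soft2 \<Rightarrow> real) \<Rightarrow> bool" where
  "sim_symmetric_on D S \<longleftrightarrow> (\<forall>(F, G)\<in>D. S F G = S G F)"

definition sim_bounded_on ::
  "(('e, 'x) soft2 \<times> ('e, 'x) soft2) set \<Rightarrow> (('e, 'x) soft2 \<Rightarrow> ('e, 'x) soft2 \<Rightarrow> real) \<Rightarrow> bool" where
  "sim_bounded_on D S \<longleftrightarrow> (\<forall>(F, G)\<in>D. 0 \<le> S F G \<and> S F G \<le> 1)"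

definition sim_identity_on ::
  "(('e, 'x) soft2 \<times> ('e, 'x) soft2) set \<Rightarrow> (('e, 'x) soft2 \<Rightarrow> ('e, 'x) soft2 \<Rightarrow> real) \<Rightarrow> bool" where
  "sim_identity_on D S \<longleftrightarrow> (\<forall>(F, G)\<in>D. S F G = 1 \<longleftrightarrow> F \<approx>\<^sub>2 G)"

definition sim_monotone_on ::
  "(('e, 'x) soft2 \<times> ('e, 'x) soft2) set \<Rightarrow> (('e, 'x) soft2 \<Rightarrow> ('e, 'x) soft2 \<Rightarrow> real) \<Rightarrow> bool" where
  "sim_monotone_on D S \<longleftrightarrow>
     (\<forall>F G H. (F, G) \<in> D \<and> (G, H) \<in> D \<and> (F, H) \<in> D \<and> F \<sqsubseteq>\<^sub>2 G \<and> G \<sqsubseteq>\<^sub>2 H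
        \<longrightarrow> S F H \<le> min (S F G) (S G H))"

definition similarity_measure_on ::
  "(('e, 'x) soft2 \<times> ('e, 'x) soft2) set \<Rightarrow> (('e, 'x) soft2 \<Rightarrow> ('e, 'x) soft2 \<Rightarrow> real) \<Rightarrow> bool" where
  "similarity_measure_on D S \<longleftrightarrow>
     sim_symmetric_on D S \<and> sim_bounded_on D S \<and> sim_identity_on D S \<and> sim_monotone_on D S"

text \<open>Pairs for which every quotient inside the sum of \<^const>\<open>S_alpha\<close> has a nonzero denominator.\<close>

definition defined_pairs ::
  "'x set \<Rightarrow> 'e set \<Rightarrow> (('e, 'x) soft2 \<times> ('e, 'x) soft2) set" where
  "defined_pairs X E = {(F, G). F \<in> soft2_sets X E \<and> G \<in> soft2_sets X E \<and>
     (\<forall>\<alpha>\<in>prim F \<inter> prim G. \<forall>\<beta>\<in>dom (soft_at F \<alpha>) \<inter> dom (soft_at G \<alpha>).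
        the (soft_at F \<alpha> \<beta>) \<union> the (soft_at G \<alpha> \<beta>) \<noteq> {})}"

text \<open>
  Pairs for which in addition the prefactors \<open>1 / |A \<union> B|\<close> and \<open>1 / |E\<^sub>A\<^sup>\<alpha> \<union> E\<^sub>B\<^sup>\<alpha>|\<close> have
  nonzero denominators.  Otherwise the case \<open>0\<close> of the formula applies to empty parameter
  sets: a type-2 soft set with no primary parameters, or one with \<open>E\<^sub>A\<^sup>\<alpha> = {}\<close> for some
  \<open>\<alpha> \<in> A\<close>, has similarity less than \<open>1\<close> to itself.
\<close>

definition nondegenerate_pairs ::
  "'x set \<Rightarrow> 'e set \<Rightarrow> (('e, 'x) soft2 \<times> ('e, 'x) soft2) set" where
  "nondegenerate_pairs X E = {(F, G) \<in> defined_pairs X E.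
     prim F \<union> prim G \<noteq> {} \<and>
     (\<forall>\<alpha>\<in>prim F \<inter> prim G. dom (soft_at F \<alpha>) \<union> dom (soft_at G \<alpha>) \<noteq> {})}"

end

theory Submission
  imports Defs
begin

text \<open>
  Both levels of \<^const>\<open>S_m\<close> have the shape \<open>(\<Sum>x\<in>A \<inter> B. r x) / |A \<union> B|\<close> with weights
  \<open>r x \<in> [0, 1]\<close>: at the lower level the weights are Jaccard indices, at the upper level they are
  the values \<open>S(\<alpha>)\<close>.  Such an expression lies in \<open>[0, 1]\<close>, and equals \<open>1\<close> exactly if \<open>A = B\<close> is
  nonempty and all weights are \<open>1\<close>.  It decreases if \<open>A\<close> shrinks inside \<open>B\<close> or if \<open>B\<close> grows.
  Applying these three facts twice gives all axioms.
\<close>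

text \<open>The case distinctions of \<open>S_alpha\<close> and \<open>S_m\<close> are absorbed:
  over an empty intersection the sum is 0, and 0 divided by any number, even by 0, is 0.\<close>

definition overlap_mean :: "'a set \<Rightarrow> 'a set \<Rightarrow> ('a \<Rightarrow> real) \<Rightarrow> real" where
  "overlap_mean A B r = (\<Sum>x\<in>A \<inter> B. r x) / real (card (A \<union> B))"

definition jaccard :: "'a set \<Rightarrow> 'a set \<Rightarrow> real" where
  "jaccard U V = real (card (U \<inter> V)) / real (card (U \<union> V))"

section \<open>General properties of overlap means\<close>

lemma overlap_mean_commute:
  assumes "\<And>x. r x = s x"
  shows "overlap_mean A B r = overlap_mean B A s"
  using assms by (simp add: overlap_mean_def Int_commute Un_commute)

lemma overlap_mean_nonneg:
  assumes "\<And>x. x \<in> A \<inter> B \<Longrightarrow> 0 \<le> r x"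
  shows "0 \<le> overlap_mean A B r"
  unfolding overlap_mean_def using assms by (intro divide_nonneg_nonneg sum_nonneg) auto

lemma sum_le_card:
  fixes r :: "'a \<Rightarrow> real"
  assumes "\<And>x. x \<in> A \<Longrightarrow> r x \<le> 1"
  shows "(\<Sum>x\<in>A. r x) \<le> real (card A)"
  using sum_mono[of A r "\<lambda>_. 1"] assms by simp

lemma card_Int_le_card_Un: "finite A \<Longrightarrow> finite B \<Longrightarrow> card (A \<inter> B) \<le> card (A \<union> B)"
  by (intro card_mono) auto

lemma overlap_mean_le_1:
  assumes "finite A" "finite B" and "\<And>x. x \<in> A \<inter> B \<Longrightarrow> r x \<le> 1"
  shows "overlap_mean A B r \<le> 1"
proof -
  have "(\<Sum>x\<in>A \<inter> B. r x) \<le> real (card (A \<union> B))"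
    using sum_le_card[of "A \<inter> B" r] card_Int_le_card_Un[of A B] assms by simp
  then show ?thesis
    unfolding overlap_mean_def by (intro divide_le_eq_1[THEN iffD2]) linarith
qed

text \<open>The sum is at most |A Int B|, which is at most |A Un B|. The value 1 turns both bounds
  into equalities: the second gives \<open>A = B\<close>, the first makes every weight 1.\<close>

lemma overlap_mean_eq_1D:
  assumes "finite A" "finite B" and le: "\<And>x. x \<in> A \<inter> B \<Longrightarrow> r x \<le> 1"
    and eq: "overlap_mean A B r = 1"
  shows "A = B" "\<And>x. x \<in> A \<Longrightarrow> r x = 1"
proof -
  have sum: "(\<Sum>x\<in>A \<inter> B. r x) = real (card (A \<union> B))"
    using eq unfolding overlap_mean_def by (metis divide_eq_1_iff)
  then have card: "card (A \<inter> B) = card (A \<union> B)"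
    using sum_le_card[of "A \<inter> B" r, OF le] card_Int_le_card_Un[OF assms(1,2)] by linarith
  have "A \<inter> B = A \<union> B"
    using assms(1,2) card by (intro card_subset_eq) auto
  then show AB: "A = B"
    by auto
  \<comment> \<open>The deficits \<open>1 - r x\<close> are nonnegative, so a zero total makes each
    of them 0.\<close>
  have "(\<Sum>x\<in>A. 1 - r x) = 0"
    using sum AB by (simp add: sum_subtractf)
  then have "\<forall>x\<in>A. 1 - r x = 0"
    using assms(1) le AB by (subst (asm) sum_nonneg_eq_0_iff) auto
  then show "r x = 1" if "x \<in> A" for x
    using that by auto
qed

lemma overlap_mean_self_eq_1:
  assumes "finite A" "A \<noteq> {}" and "\<And>x. x \<in> A \<Longrightarrow> r x = 1"
  shows "overlap_mean A A r = 1"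
  using assms by (simp add: overlap_mean_def)

text \<open>For nested sets the intersections are the smaller sets and the unions the larger ones,
  so the numerator grows and the denominator shrinks. Both bounds of (s4) are instances:
  \<open>A' = A\<close> for the first, \<open>B' = B\<close> for the second.\<close>

lemma overlap_mean_mono:
  assumes "finite B" "A \<subseteq> A'" "A' \<subseteq> B'" "B' \<subseteq> B"
    and le: "\<And>x. x \<in> A \<Longrightarrow> r x \<le> r' x" and nonneg: "\<And>x. x \<in> A' \<Longrightarrow> 0 \<le> r' x"
  shows "overlap_mean A B r \<le> overlap_mean A' B' r'"
\<comment> \<open>If \<open>A'\<close> is empty, \<open>card B'\<close> may be 0, but both means
  vanish. Otherwise \<open>card B'\<close> is positive, as \<open>frac_le\<close> requires.\<close>
proof (cases "A' = {}")
  case True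
  then show ?thesis
    using assms by (simp add: overlap_mean_def)
next
  case False
  have fin: "finite A'" "finite B'"
    using assms by (auto intro: finite_subset)
  have "(\<Sum>x\<in>A. r x) \<le> (\<Sum>x\<in>A. r' x)"
    using le by (rule sum_mono)
  also have "\<dots> \<le> (\<Sum>x\<in>A'. r' x)"
    using assms fin by (intro sum_mono2) auto
  finally have sum: "(\<Sum>x\<in>A. r x) \<le> (\<Sum>x\<in>A'. r' x)" .
  have "card B' > 0" "card B' \<le> card B"
    using assms False fin by (auto simp: card_gt_0_iff intro: card_mono)
  then have "(\<Sum>x\<in>A. r x) / real (card B) \<le> (\<Sum>x\<in>A'. r' x) / real (card B')"
    using sum nonneg by (intro frac_le sum_nonneg) auto
  then show ?thesis
    using assms order_trans[of A A' B'] order_trans[of A B' B]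
    by (simp add: overlap_mean_def Int_absorb2 Un_absorb1)
qed

section \<open>Jaccard index of two sets\<close>

lemma jaccard_commute: "jaccard U V = jaccard V U"
  by (simp add: jaccard_def Int_commute Un_commute)

lemma jaccard_nonneg: "0 \<le> jaccard U V"
  by (simp add: jaccard_def)

text \<open>For infinite \<open>U \<union> V\<close> the index is \<open>x / 0 = 0\<close>, so the next two facts hold for all sets.\<close>

lemma jaccard_le_1: "jaccard U V \<le> 1"
proof (cases "finite (U \<union> V)")
  case True
  then have "card (U \<inter> V) \<le> card (U \<union> V)"
    by (intro card_mono) auto
  then show ?thesis
    unfolding jaccard_def by (intro divide_le_eq_1[THEN iffD2]) linarith
qed (auto simp: jaccard_def)

lemma jaccard_eq_1D:
  assumes "jaccard U V = 1"
  shows "U = V"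
proof -
  have "card (U \<inter> V) = card (U \<union> V)" "finite (U \<union> V)"
    using assms unfolding jaccard_def by (force, metis card.infinite div_by_0 of_nat_0 zero_neq_one)
  then have "U \<inter> V = U \<union> V"
    by (intro card_subset_eq) auto
  then show ?thesis
    by auto
qed

lemma jaccard_self_eq_1: "finite U \<Longrightarrow> U \<noteq> {} \<Longrightarrow> jaccard U U = 1"
  by (simp add: jaccard_def)

section \<open>The similarity as an iterated overlap mean\<close>

lemma S_alpha_eq_overlap_mean:
  "S_alpha F G \<alpha> = overlap_mean (dom (soft_at F \<alpha>)) (dom (soft_at G \<alpha>))
     (\<lambda>\<beta>. jaccard (the (soft_at F \<alpha> \<beta>)) (the (soft_at G \<alpha> \<beta>)))"
  by (auto simp: S_alpha_def overlap_mean_def jaccard_def Let_def)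

lemma S_m_eq_overlap_mean: "S_m F G = overlap_mean (prim F) (prim G) (S_alpha F G)"
  by (auto simp: S_m_def overlap_mean_def)

lemma S_alpha_commute: "S_alpha F G \<alpha> = S_alpha G F \<alpha>"
  unfolding S_alpha_eq_overlap_mean by (intro overlap_mean_commute jaccard_commute)

lemma S_m_commute: "S_m F G = S_m G F"
  unfolding S_m_eq_overlap_mean by (intro overlap_mean_commute S_alpha_commute)

lemma S_alpha_nonneg: "0 \<le> S_alpha F G \<alpha>"
  unfolding S_alpha_eq_overlap_mean by (intro overlap_mean_nonneg jaccard_nonneg)

lemma S_m_nonneg: "0 \<le> S_m F G"
  unfolding S_m_eq_overlap_mean by (intro overlap_mean_nonneg S_alpha_nonneg)

lemma finite_prim: "F \<in> soft2_sets X E \<Longrightarrow> finite E \<Longrightarrow> finite (prim F)"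
  unfolding soft2_sets_def using finite_subset[of "prim F" E] by simp

lemma finite_dom_soft_at:
  "F \<in> soft2_sets X E \<Longrightarrow> finite E \<Longrightarrow> \<alpha> \<in> prim F \<Longrightarrow> finite (dom (soft_at F \<alpha>))"
  unfolding soft2_sets_def using finite_subset[of "dom (soft_at F \<alpha>)" E] by blast

text \<open>This is how finiteness of \<open>X\<close> enters: the values are finite, so a nonempty
  value has Jaccard index 1 with itself.\<close>

lemma soft_at_subset:
  assumes "F \<in> soft2_sets X E" "\<alpha> \<in> prim F" "\<beta> \<in> dom (soft_at F \<alpha>)"
  shows "the (soft_at F \<alpha> \<beta>) \<subseteq> X"
proof -
  have "the (soft_at F \<alpha> \<beta>) \<in> ran (soft_at F \<alpha>)"
    using assms(3) by (auto intro: ranI)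
  then show ?thesis
    using assms(1,2) unfolding soft2_sets_def soft1_sets_def by blast
qed

context
  fixes X :: "'x set" and E :: "'e set"
  assumes E: "finite E"
begin

lemma S_alpha_le_1:
  assumes "F \<in> soft2_sets X E" "G \<in> soft2_sets X E" "\<alpha> \<in> prim F \<inter> prim G"
  shows "S_alpha F G \<alpha> \<le> 1"
  unfolding S_alpha_eq_overlap_mean
  using assms by (intro overlap_mean_le_1 finite_dom_soft_at[OF _ E] jaccard_le_1) auto

lemma S_m_le_1:
  assumes "F \<in> soft2_sets X E" "G \<in> soft2_sets X E"
  shows "S_m F G \<le> 1"
  unfolding S_m_eq_overlap_mean
  using assms by (intro overlap_mean_le_1 finite_prim[OF _ E] S_alpha_le_1) auto

lemma S_alpha_eq_1D:
  assumes "F \<in> soft2_sets X E" "G \<in> soft2_sets X E" "\<alpha> \<in> prim F \<inter> prim G"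
    and eq: "S_alpha F G \<alpha> = 1"
  shows "soft_at F \<alpha> = soft_at G \<alpha>"
proof -
  have fin: "finite (dom (soft_at F \<alpha>))" "finite (dom (soft_at G \<alpha>))"
    using assms by (auto intro: finite_dom_soft_at[OF _ E])
  note mean = eq[unfolded S_alpha_eq_overlap_mean]
  have dom: "dom (soft_at F \<alpha>) = dom (soft_at G \<alpha>)"
    using fin jaccard_le_1 mean by (rule overlap_mean_eq_1D(1))
  have val: "the (soft_at F \<alpha> \<beta>) = the (soft_at G \<alpha> \<beta>)" if "\<beta> \<in> dom (soft_at F \<alpha>)" for \<beta>
    using fin jaccard_le_1 mean that by (intro jaccard_eq_1D) (rule overlap_mean_eq_1D(2))
  show ?thesis
  proof
    fix \<beta>
    \<comment> \<open>Outside the common domain both maps are \<open>None\<close>.\<close>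
    show "soft_at F \<alpha> \<beta> = soft_at G \<alpha> \<beta>"
      using dom val by (metis domIff option.expand)
  qed
qed

text \<open>The equality case of overlap means is used at both levels. The value 1 itself rules out
  empty index sets and empty values.\<close>

lemma S_m_eq_1D:
  assumes "F \<in> soft2_sets X E" "G \<in> soft2_sets X E" and eq: "S_m F G = 1"
  shows "F \<approx>\<^sub>2 G"
proof -
  note fin = finite_prim[OF assms(1) E] finite_prim[OF assms(2) E]
  note mean = eq[unfolded S_m_eq_overlap_mean]
  have prim: "prim F = prim G"
    using fin S_alpha_le_1[OF assms(1,2)] mean by (rule overlap_mean_eq_1D(1))
  have "S_alpha F G \<alpha> = 1" if "\<alpha> \<in> prim F" for \<alpha>
    using fin S_alpha_le_1[OF assms(1,2)] mean that by (rule overlap_mean_eq_1D(2))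
  then have "soft_at F \<alpha> = soft_at G \<alpha>" if "\<alpha> \<in> prim F" for \<alpha>
    using that prim assms(1,2) by (intro S_alpha_eq_1D) auto
  then show ?thesis
    using prim by (auto simp: soft2_eq_def soft2_le_def)
qed

text \<open>Nondegeneracy of the pair of \<open>F\<close> with itself excludes an empty primary set,
  empty domains and empty values; each would put a 0 where a 1 is needed.\<close>

lemma S_m_self_eq_1:
  assumes "finite X" "(F, F) \<in> nondegenerate_pairs X E"
  shows "S_m F F = 1"
proof -
  have F: "F \<in> soft2_sets X E"
    using assms(2) by (simp add: nondegenerate_pairs_def defined_pairs_def)
  have "S_alpha F F \<alpha> = 1" if \<alpha>: "\<alpha> \<in> prim F" for \<alpha>
    unfolding S_alpha_eq_overlap_mean
  proof (rule overlap_mean_self_eq_1)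
    show "finite (dom (soft_at F \<alpha>))"
      using F E \<alpha> by (rule finite_dom_soft_at)
    show "dom (soft_at F \<alpha>) \<noteq> {}"
      using assms(2) \<alpha> by (auto simp: nondegenerate_pairs_def)
    fix \<beta> assume \<beta>: "\<beta> \<in> dom (soft_at F \<alpha>)"
    show "jaccard (the (soft_at F \<alpha> \<beta>)) (the (soft_at F \<alpha> \<beta>)) = 1"
    proof (rule jaccard_self_eq_1)
      show "finite (the (soft_at F \<alpha> \<beta>))"
        using soft_at_subset[OF F \<alpha> \<beta>] assms(1) by (rule finite_subset)
      show "the (soft_at F \<alpha> \<beta>) \<noteq> {}"
        using assms(2) \<alpha> \<beta> unfolding nondegenerate_pairs_def defined_pairs_def by blast
    qed
  qed
  moreover have "prim F \<noteq> {}"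
    using assms(2) by (auto simp: nondegenerate_pairs_def)
  ultimately show ?thesis
    unfolding S_m_eq_overlap_mean using F by (intro overlap_mean_self_eq_1 finite_prim[OF _ E])
qed

text \<open>
  Along a chain \<open>F \<sqsubseteq> G \<sqsubseteq> H\<close> the three maps agree on the smallest domain, so the Jaccard
  weights coincide there and only the index sets change.
\<close>

lemma S_alpha_mono:
  assumes "F \<sqsubseteq>\<^sub>2 G" "G \<sqsubseteq>\<^sub>2 H" "H \<in> soft2_sets X E" "\<alpha> \<in> prim F"
  shows "S_alpha F H \<alpha> \<le> S_alpha F G \<alpha>" "S_alpha F H \<alpha> \<le> S_alpha G H \<alpha>"
proof -
  have FG: "soft_at F \<alpha> \<subseteq>\<^sub>m soft_at G \<alpha>" and GH: "soft_at G \<alpha> \<subseteq>\<^sub>m soft_at H \<alpha>"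
    and H: "\<alpha> \<in> prim H"
    using assms by (auto simp: soft2_le_def)
  have dom: "dom (soft_at F \<alpha>) \<subseteq> dom (soft_at G \<alpha>)" "dom (soft_at G \<alpha>) \<subseteq> dom (soft_at H \<alpha>)"
    using FG GH by (simp_all add: map_le_implies_dom_le)
  have agree: "soft_at F \<alpha> \<beta> = soft_at G \<alpha> \<beta>" "soft_at H \<alpha> \<beta> = soft_at G \<alpha> \<beta>"
    if "\<beta> \<in> dom (soft_at F \<alpha>)" for \<beta>
    using FG GH dom that unfolding map_le_def by (blast, metis subsetD)
  note fin = finite_dom_soft_at[OF assms(3) E H]
  show "S_alpha F H \<alpha> \<le> S_alpha F G \<alpha>" "S_alpha F H \<alpha> \<le> S_alpha G H \<alpha>"
    unfolding S_alpha_eq_overlap_mean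
    using dom by (intro overlap_mean_mono fin jaccard_nonneg; simp add: agree)+
qed

text \<open>Here the primary sets are nested as well, but the weights may change along the chain;
  \<open>S_alpha_mono\<close> compares them on \<open>prim F\<close>.\<close>

lemma S_m_mono:
  assumes "F \<sqsubseteq>\<^sub>2 G" "G \<sqsubseteq>\<^sub>2 H" "H \<in> soft2_sets X E"
  shows "S_m F H \<le> min (S_m F G) (S_m G H)"
proof -
  have "prim F \<subseteq> prim G" "prim G \<subseteq> prim H"
    using assms(1,2) by (auto simp: soft2_le_def)
  then have "S_m F H \<le> S_m F G" "S_m F H \<le> S_m G H"
    unfolding S_m_eq_overlap_mean
    using finite_prim[OF assms(3) E]
    by (intro overlap_mean_mono S_alpha_nonneg S_alpha_mono[OF assms]; simp)+
  then show ?thesis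
    by simp
qed

end

theorem theorem5p6:
  fixes X :: "'x set" and E :: "'e set"
  assumes "finite X" and "finite E"
  shows "similarity_measure_on (nondegenerate_pairs X E) S_m
    \<and> sim_symmetric_on (defined_pairs X E) S_m
    \<and> sim_bounded_on (defined_pairs X E) S_m
    \<and> (\<forall>(F, G)\<in>defined_pairs X E. S_m F G = 1 \<longrightarrow> F \<approx>\<^sub>2 G)
    \<and> sim_monotone_on (defined_pairs X E) S_m"
proof -
  have sub: "nondegenerate_pairs X E \<subseteq> defined_pairs X E"
    by (auto simp: nondegenerate_pairs_def)
  have defd: "F \<in> soft2_sets X E" "G \<in> soft2_sets X E" if "(F, G) \<in> defined_pairs X E" for F G
    using that by (auto simp: defined_pairs_def)
  have symm: "sim_symmetric_on D S_m" for D :: "(('e, 'x) soft2 \<times> ('e, 'x) soft2) set"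
    by (auto simp: sim_symmetric_on_def intro: S_m_commute)
  \<comment> \<open>Both properties pass to smaller sets of pairs, so one argument serves the
    defined and the nondegenerate pairs.\<close>
  have bounded: "sim_bounded_on D S_m" and mono: "sim_monotone_on D S_m"
    if "D \<subseteq> defined_pairs X E" for D
  proof -
    show "sim_bounded_on D S_m"
      unfolding sim_bounded_on_def using that defd S_m_nonneg S_m_le_1[OF assms(2)] by blast
    show "sim_monotone_on D S_m"
      unfolding sim_monotone_on_def using that defd S_m_mono[OF assms(2)] by blast
  qed
  have eqD: "\<forall>(F, G)\<in>defined_pairs X E. S_m F G = 1 \<longrightarrow> F \<approx>\<^sub>2 G"
    using defd S_m_eq_1D[OF assms(2)] by blast
  \<comment> \<open>Mutual containment is equality of type-2 soft sets, which reduces this direction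
    of (s3) to self-similarity.\<close>
  have "S_m F G = 1" if "(F, G) \<in> nondegenerate_pairs X E" "F \<approx>\<^sub>2 G" for F G
  proof -
    have "F = G"
      using that sub defd soft2_eq_iff_eq by blast
    then show ?thesis
      using that(1) S_m_self_eq_1[OF assms(2,1)] by simp
  qed
  then have "sim_identity_on (nondegenerate_pairs X E) S_m"
    using eqD sub unfolding sim_identity_on_def by blast
  then show ?thesis
    unfolding similarity_measure_on_def using symm bounded mono sub eqD by simp
qed

end
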